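(* Let $k$, $n$ and $s$ be positive integers, let $x_1,\ldots,x_n$ be independent variables, and write $E_k^{(s)}$, $H_k^{(s)}$, $P_i^{(s)}$ for these functions evaluated at $(x_1,\ldots,x_n)$. Then, summing over tuples of nonnegative integers $(t_1,\ldots,t_k)$, $$H_k^{(s)}=\sum_{t_1+2t_2+\cdots+kt_k=k}\frac{1}{1^{t_1}t_1!\,2^{t_2}t_2!\cdots k^{t_k}t_k!}\prod_{i=1}^k\big(P_i^{(s)}\big)^{t_i}$$ and $$E_k^{(s)}=\sum_{t_1+2t_2+\cdots+kt_k=k}\frac{(-1)^{k+t_1+\cdots+t_k}}{1^{t_1}t_1!\,2^{t_2}t_2!\cdots k^{t_k}t_k!}\prod_{i=1}^k\big(P_i^{(s)}\big)^{t_i}.$$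
   Context: For a positive integer $s$, $H_k^{(s)}$ and $E_k^{(s)}$ ($k\ge0$) are defined by the formal power series identities $$\sum_{k\ge0}H_k^{(s)}(x_1,\ldots,x_n)t^k=\prod_{i=1}^n\big(1-x_it+\cdots+(-x_it)^s\big)^{-1},\qquad \sum_{k\ge0}E_k^{(s)}(x_1,\ldots,x_n)t^k=\prod_{i=1}^n\big(1+x_it+\cdots+(x_it)^s\big).$$ $P_k^{(s)}(x_1,\ldots,x_n)=c_k^{(s)}\sum_{i=1}^n x_i^k$, where $c_k^{(s)}=(-1)^k s$ if $k\equiv0\pmod{s+1}$ and $c_k^{(s)}=(-1)^{k-1}$ otherwise. *)

theory Defs
  imports
    "HOL-Computational_Algebra.Computational_Algebra"
    "HOL-Library.FuncSet"
    "HOL-Library.Poly_Mapping"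
begin

text \<open>
  Polynomials over \<open>'a\<close> in independent variables indexed by the natural numbers, as
  finitely supported functions from monomials to coefficients. The statement uses only the
  variables with index in \<open>{1..n}\<close>.
\<close>

type_synonym 'a mpoly = "(nat \<Rightarrow>\<^sub>0 nat) \<Rightarrow>\<^sub>0 'a"

definition Var :: "nat \<Rightarrow> 'a::comm_ring_1 mpoly" where
  "Var i = Poly_Mapping.single (Poly_Mapping.single i 1) 1"

definition Const :: "'a::comm_ring_1 \<Rightarrow> 'a mpoly" where
  "Const c = Poly_Mapping.single 0 c"

text \<open>
  The functions \<open>E\<close>, \<open>H\<close>, \<open>P\<close> at a point \<open>(x 1, \<dots>, x n)\<close> of a commutative ring; in the
  generating series the formal variable \<open>t\<close> is \<^const>\<open>fps_X\<close>.
\<close>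

definition E_fun :: "nat \<Rightarrow> nat \<Rightarrow> (nat \<Rightarrow> 'b::comm_ring_1) \<Rightarrow> nat \<Rightarrow> 'b" where
  "E_fun s n x k =
     fps_nth (\<Prod>i=1..n. \<Sum>j=0..s. (fps_const (x i) * fps_X) ^ j) k"

text \<open>
  The coefficients form a ring that is not a field, so the \<^class>\<open>inverse\<close> operation on
  power series is not available. Instead we use the library's \<^term>\<open>fps_right_inverse f 1\<close>,
  which is the multiplicative inverse of a series \<open>f\<close> with constant term 1.
\<close>

definition H_fun :: "nat \<Rightarrow> nat \<Rightarrow> (nat \<Rightarrow> 'b::comm_ring_1) \<Rightarrow> nat \<Rightarrow> 'b" where
  "H_fun s n x k =
     fps_nth (\<Prod>i=1..n. fps_right_inverse (\<Sum>j=0..s. (- (fps_const (x i) * fps_X)) ^ j) 1) k"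

lemma H_factor_inverse:
  fixes a :: "'b::comm_ring_1" and s :: nat
  defines "f \<equiv> (\<Sum>j=0..s. (- (fps_const a * fps_X)) ^ j)"
  shows "f * fps_right_inverse f 1 = 1"
proof (rule fps_right_inverse)
  have "fps_nth ((- (fps_const a * fps_X)) ^ j) 0 = (if j = 0 then 1 else 0)" for j
    by (cases j) simp_all
  then show "fps_nth f 0 * 1 = 1"
    by (simp add: f_def fps_sum_nth)
qed

definition P_coeff :: "nat \<Rightarrow> nat \<Rightarrow> 'b::comm_ring_1" where
  "P_coeff s k = (if k mod (s + 1) = 0 then (-1) ^ k * of_nat s else (-1) ^ (k - 1))"

definition P_fun :: "nat \<Rightarrow> nat \<Rightarrow> (nat \<Rightarrow> 'b::comm_ring_1) \<Rightarrow> nat \<Rightarrow> 'b" where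
  "P_fun s n x k = P_coeff s k * (\<Sum>i=1..n. x i ^ k)"

text \<open>
  The tuples \<open>(t\<^sub>1, \<dots>, t\<^sub>k)\<close> with \<open>t\<^sub>1 + 2 t\<^sub>2 + \<dots> + k t\<^sub>k = k\<close>. Extensionality makes each
  tuple correspond to exactly one function; the set is finite.
\<close>

definition weighted_tuples :: "nat \<Rightarrow> (nat \<Rightarrow> nat) set" where
  "weighted_tuples k = {t \<in> {1..k} \<rightarrow>\<^sub>E UNIV. (\<Sum>i=1..k. i * t i) = k}"

lemma finite_weighted_tuples: "finite (weighted_tuples k)"
proof (rule finite_subset)
  show "weighted_tuples k \<subseteq> {1..k} \<rightarrow>\<^sub>E {0..k}"
  proof
    fix t assume t: "t \<in> weighted_tuples k"
    have "t i \<le> k" if "i \<in> {1..k}" for i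
    proof -
      have "t i \<le> i * t i" using that by simp
      also have "\<dots> \<le> (\<Sum>i=1..k. i * t i)"
        by (rule member_le_sum) (use that in auto)
      also have "\<dots> = k" using t by (simp add: weighted_tuples_def)
      finally show ?thesis .
    qed
    then show "t \<in> {1..k} \<rightarrow>\<^sub>E {0..k}"
      using t by (auto simp: weighted_tuples_def PiE_iff)
  qed
qed (auto intro: finite_PiE)

definition z_weight :: "nat \<Rightarrow> (nat \<Rightarrow> nat) \<Rightarrow> nat" where
  "z_weight k t = (\<Prod>i=1..k. i ^ t i * fact (t i))"

end

theory Submission
  imports Defs
begin

text \<open>
  Let \<open>p\<close> be a sequence in a ring in which all positive integers are invertible. A series \<open>f\<close>
  with constant term 1 and \<open>t f' = f \<cdot> (\<Sum>i\<ge>1. p\<^sub>i t\<^sup>i)\<close> is unique, since its coefficients satisfy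
  the Newton-type recurrence \<open>k f\<^sub>k = (\<Sum>i=1..k. p\<^sub>i f\<^sub>k\<^sub>-\<^sub>i)\<close>. The sum over tuples satisfies the same
  recurrence: write \<open>k = (\<Sum>i. i t\<^sub>i)\<close> and remove one part of size \<open>i\<close> from \<open>t\<close>. On the other
  hand the logarithmic derivative of a factor comes from
  \<open>1 + y + \<dots> + y\<^sup>s = (1 - y\<^sup>s\<^sup>+\<^sup>1) / (1 - y)\<close>, which is where the coefficients of the \<open>P\<^sub>i\<close> originate.
\<close>

section \<open>Sums over weighted tuples\<close>

text \<open>
  Keeping the index range \<open>{1..N}\<close> independent of the weight \<open>k\<close> makes the removal of a part
  a map between tuples of the same shape.
\<close>

definition tuples :: "nat \<Rightarrow> nat \<Rightarrow> (nat \<Rightarrow> nat) set" where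
  "tuples N k = {t \<in> {1..N} \<rightarrow>\<^sub>E UNIV. (\<Sum>i=1..N. i * t i) = k}"

lemma tuples_part_le:
  assumes "t \<in> tuples N k" "i \<in> {1..N}"
  shows "i * t i \<le> k"
proof -
  have "i * t i \<le> (\<Sum>i=1..N. i * t i)"
    by (rule member_le_sum) (use assms in auto)
  then show ?thesis using assms by (simp add: tuples_def)
qed

lemma finite_tuples: "finite (tuples N k)"
proof (rule finite_subset)
  show "tuples N k \<subseteq> {1..N} \<rightarrow>\<^sub>E {0..k}"
  proof
    fix t assume t: "t \<in> tuples N k"
    have "t i \<le> k" if "i \<in> {1..N}" for i
    proof -
      have "t i \<le> i * t i" using that by simp
      also have "\<dots> \<le> k" using tuples_part_le[OF t that] .
      finally show ?thesis .
    qed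
    then show "t \<in> {1..N} \<rightarrow>\<^sub>E {0..k}"
      using t by (auto simp: tuples_def PiE_iff)
  qed
qed (auto intro: finite_PiE)

lemma tuples_0: "tuples N 0 = {\<lambda>i\<in>{1..N}. 0}"
  by (auto simp: tuples_def PiE_iff extensional_def fun_eq_iff)

lemma sum_upd_Suc:
  fixes t :: "nat \<Rightarrow> nat"
  assumes "i \<in> {1..N}"
  shows "(\<Sum>j=1..N. j * (t(i := Suc (t i))) j) = i + (\<Sum>j=1..N. j * t j)"
  using assms by (simp add: sum.remove[where x = i])

text \<open>This is the reindexing behind \<open>tuple_sum_rec\<close>: inserting and deleting a
  part of size \<open>i\<close> undo each other, and \<open>t i > 0\<close> keeps
  \<open>t i - 1\<close> from being truncated.\<close>

lemma bij_betw_add_part: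
  assumes i: "i \<in> {1..N}" "i \<le> k"
  shows "bij_betw (\<lambda>t. t(i := Suc (t i))) (tuples N (k - i)) {t \<in> tuples N k. t i > 0}"
proof (rule bij_betw_byWitness[where f' = "\<lambda>t. t(i := t i - 1)"])
  show "(\<lambda>t. t(i := Suc (t i))) ` tuples N (k - i) \<subseteq> {t \<in> tuples N k. t i > 0}"
    using i sum_upd_Suc[OF i(1)] by (auto simp: tuples_def PiE_iff extensional_def)
  have "t(i := t i - 1) \<in> tuples N (k - i)" if t: "t \<in> tuples N k" "t i > 0" for t
    using i t sum_upd_Suc[OF i(1), of "t(i := t i - 1)"]
    by (auto simp: tuples_def PiE_iff extensional_def)
  then show "(\<lambda>t. t(i := t i - 1)) ` {t \<in> tuples N k. t i > 0} \<subseteq> tuples N (k - i)"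
    by auto
qed auto

lemma z_weight_pos: "z_weight N t > 0"
  unfolding z_weight_def by (rule prod_pos) auto

lemma z_weight_add_part:
  assumes "i \<in> {1..N}"
  shows "z_weight N (t(i := Suc (t i))) = i * Suc (t i) * z_weight N t"
  using assms by (simp add: z_weight_def prod.remove[where x = i] algebra_simps)

text \<open>A polynomial ring has no division, so reciprocals enter through a function
  \<open>r\<close>, of which the context below assumes only that it inverts the positive
  integers.\<close>

definition tuple_term :: "(nat \<Rightarrow> 'b::comm_ring_1) \<Rightarrow> (nat \<Rightarrow> 'b) \<Rightarrow> nat \<Rightarrow> (nat \<Rightarrow> nat) \<Rightarrow> 'b" where
  "tuple_term r p N t = r (z_weight N t) * (\<Prod>i=1..N. p i ^ t i)"

definition tuple_sum :: "(nat \<Rightarrow> 'b::comm_ring_1) \<Rightarrow> (nat \<Rightarrow> 'b) \<Rightarrow> nat \<Rightarrow> nat \<Rightarrow> 'b" where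
  "tuple_sum r p N k = (\<Sum>t\<in>tuples N k. tuple_term r p N t)"

context
  fixes r :: "nat \<Rightarrow> 'b::comm_ring_1"
  assumes r: "\<And>m. m > 0 \<Longrightarrow> of_nat m * r m = 1"
begin

lemma of_nat_cancel:
  fixes a b :: 'b
  assumes "of_nat m * a = of_nat m * b" "m > 0"
  shows "a = b"
proof -
  have "r m * of_nat m = 1" using r[OF assms(2)] by (simp only: mult.commute)
  then have *: "r m * (of_nat m * c) = c" for c
    by (simp only: mult_1 flip: mult.assoc)
  have "r m * (of_nat m * a) = r m * (of_nat m * b)" by (simp only: assms(1))
  then show ?thesis unfolding * .
qed

text \<open>A further part \<open>i\<close> multiplies the weight by \<open>i * Suc (t i)\<close>,
  which the left factor cancels, and the product gains one factor \<open>p i\<close>.\<close>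

lemma tuple_term_add_part:
  assumes i: "i \<in> {1..N}"
  shows "of_nat (i * Suc (t i)) * tuple_term r p N (t(i := Suc (t i))) = p i * tuple_term r p N t"
proof -
  let ?z = "z_weight N t" and ?m = "i * Suc (t i)"
  \<comment> \<open>\<open>r\<close> is not assumed multiplicative. Multiplied by \<open>?z\<close>,
    both sides of the desired equation become 1, and \<open>?z\<close> can then be
    cancelled.\<close>
  have "of_nat ?z * (of_nat ?m * r (?m * ?z)) = of_nat (?m * ?z) * r (?m * ?z)"
    by (simp only: of_nat_mult ac_simps)
  also have "\<dots> = of_nat ?z * r ?z"
    using i z_weight_pos[of N t] by (simp add: r del: of_nat_mult)
  finally have *: "of_nat ?m * r (?m * ?z) = r ?z"
    by (rule of_nat_cancel) (rule z_weight_pos)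
  have "(\<Prod>j=1..N. p j ^ (t(i := Suc (t i))) j) = p i * (\<Prod>j=1..N. p j ^ t j)"
    using i by (simp add: prod.remove[where x = i] ac_simps)
  then show ?thesis
    unfolding tuple_term_def z_weight_add_part[OF i] mult.assoc[symmetric] *
    by (simp only: ac_simps)
qed

lemma tuple_sum_rec:
  assumes "k \<le> N"
  shows "of_nat k * tuple_sum r p N k = (\<Sum>i=1..k. p i * tuple_sum r p N (k - i))"
proof -
  let ?w = "tuple_term r p N"
  have "of_nat k * tuple_sum r p N k = (\<Sum>t\<in>tuples N k. \<Sum>i=1..N. of_nat (i * t i) * ?w t)"
    unfolding tuple_sum_def sum_distrib_left
  proof (rule sum.cong)
    fix t assume "t \<in> tuples N k"
    then have "of_nat k = (\<Sum>i=1..N. of_nat (i * t i) :: 'b)"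
      by (simp add: tuples_def flip: of_nat_sum of_nat_mult)
    then show "of_nat k * ?w t = (\<Sum>i=1..N. of_nat (i * t i) * ?w t)"
      by (simp only: sum_distrib_right)
  qed simp
  also have "\<dots> = (\<Sum>i=1..N. \<Sum>t\<in>tuples N k. of_nat (i * t i) * ?w t)"
    by (rule sum.swap)
  \<comment> \<open>A part larger than \<open>k\<close> cannot occur in a tuple of weight
    \<open>k\<close>.\<close>
  also have "\<dots> = (\<Sum>i=1..k. \<Sum>t\<in>tuples N k. of_nat (i * t i) * ?w t)"
  proof (rule sum.mono_neutral_right)
    show "\<forall>i\<in>{1..N} - {1..k}. (\<Sum>t\<in>tuples N k. of_nat (i * t i) * ?w t) = 0"
    proof (intro ballI sum.neutral)
      fix i t assume "i \<in> {1..N} - {1..k}" "t \<in> tuples N k"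
      then have "t i = 0" using tuples_part_le[of t N k i] by (cases "t i") auto
      then show "of_nat (i * t i) * ?w t = 0" by simp
    qed
  qed (use assms in auto)
  also have "\<dots> = (\<Sum>i=1..k. p i * tuple_sum r p N (k - i))"
  proof (rule sum.cong)
    fix i assume "i \<in> {1..k}"
    then have i: "i \<in> {1..N}" "i \<le> k" using assms by auto
    \<comment> \<open>Tuples without a part \<open>i\<close> contribute 0; the others are the image
      of the bijection.\<close>
    have "(\<Sum>t\<in>tuples N k. of_nat (i * t i) * ?w t)
        = (\<Sum>t\<in>{t\<in>tuples N k. t i > 0}. of_nat (i * t i) * ?w t)"
      by (rule sum.mono_neutral_right) (auto simp: finite_tuples)
    also have "\<dots> = (\<Sum>t\<in>tuples N (k - i).
        of_nat (i * Suc (t i)) * ?w (t(i := Suc (t i))))"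
      by (subst sum.reindex_bij_betw[OF bij_betw_add_part[OF i], symmetric]) simp
    also have "\<dots> = p i * tuple_sum r p N (k - i)"
      unfolding tuple_term_add_part[OF i(1)] by (simp add: tuple_sum_def sum_distrib_left)
    finally show "(\<Sum>t\<in>tuples N k. of_nat (i * t i) * ?w t) = p i * tuple_sum r p N (k - i)" .
  qed simp
  finally show ?thesis .
qed

text \<open>Strong induction with \<open>N\<close> fixed: the recurrence expresses \<open>k\<close>
  times the value at \<open>k\<close> by earlier values, and \<open>k\<close> can be
  cancelled.\<close>

lemma tuple_sum_unique:
  assumes f0: "f 0 = 1"
    and rec: "\<And>k. k \<ge> 1 \<Longrightarrow> of_nat k * f k = (\<Sum>i=1..k. p i * f (k - i))"
  shows "k \<le> N \<Longrightarrow> f k = tuple_sum r p N k"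
proof (induction k rule: less_induct)
  case (less k)
  show ?case
  proof (cases "k = 0")
    case True
    have "r 1 = 1" using r[of 1] by simp
    then show ?thesis
      using True f0 by (simp add: tuple_sum_def tuples_0 tuple_term_def z_weight_def)
  next
    case False
    have "(\<Sum>i=1..k. p i * f (k - i)) = (\<Sum>i=1..k. p i * tuple_sum r p N (k - i))"
      by (rule sum.cong) (use less in auto)
    then have "of_nat k * f k = of_nat k * tuple_sum r p N k"
      using rec[of k] False tuple_sum_rec[of k N p] less.prems by simp
    then show ?thesis by (rule of_nat_cancel) (use False in simp)
  qed
qed

end

section \<open>Logarithmic derivatives\<close>

text \<open>The relation \<open>q = t f' / f\<close> with the denominator cleared. The factor
  \<open>fps_X\<close> aligns the coefficient \<open>k * f_k\<close> with index
  \<open>k\<close>.\<close>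

definition log_deriv :: "'b::comm_ring_1 fps \<Rightarrow> 'b fps \<Rightarrow> bool" where
  "log_deriv f q \<longleftrightarrow> fps_X * fps_deriv f = f * q"

lemma log_deriv_1: "log_deriv 1 0"
  by (simp add: log_deriv_def)

lemma log_deriv_mult:
  assumes "log_deriv f q" "log_deriv g u"
  shows "log_deriv (f * g) (q + u)"
proof -
  have "fps_X * fps_deriv (f * g) = f * (fps_X * fps_deriv g) + (fps_X * fps_deriv f) * g"
    by (simp add: algebra_simps)
  also have "\<dots> = (f * g) * (q + u)"
    using assms by (simp add: log_deriv_def algebra_simps)
  finally show ?thesis by (simp add: log_deriv_def)
qed

lemma log_deriv_prod:
  assumes "\<And>i. i \<in> A \<Longrightarrow> log_deriv (f i) (q i)"
  shows "log_deriv (\<Prod>i\<in>A. f i) (\<Sum>i\<in>A. q i)"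
  using assms by (induction A rule: infinite_finite_induct) (auto intro: log_deriv_mult log_deriv_1)

lemma log_deriv_inverse:
  assumes f: "log_deriv f q" and fg: "f * g = 1"
  shows "log_deriv g (- q)"
proof -
  \<comment> \<open>The derivative of \<open>f * g = 1\<close> is multiplied by a further
    \<open>g\<close>, so that every term acquires the factor \<open>f * g\<close>.\<close>
  have "0 = g * (fps_X * fps_deriv (f * g))" by (simp add: fg)
  also have "\<dots> = (f * g) * (fps_X * fps_deriv g) + g * g * (fps_X * fps_deriv f)"
    by (simp add: algebra_simps)
  also have "\<dots> = (f * g) * (fps_X * fps_deriv g) + (f * g) * (g * q)"
    using f by (simp add: log_deriv_def algebra_simps)
  finally have "fps_X * fps_deriv g + g * q = 0" by (simp add: fg)
  then show ?thesis by (simp add: log_deriv_def eq_neg_iff_add_eq_0)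
qed

lemma log_deriv_nth:
  assumes "log_deriv f q" "fps_nth q 0 = 0" "k \<ge> 1"
  shows "of_nat k * fps_nth f k = (\<Sum>i=1..k. fps_nth q i * fps_nth f (k - i))"
proof -
  have "of_nat k * fps_nth f k = fps_nth (fps_X * fps_deriv f) k"
    using assms(3) by simp
  also have "\<dots> = fps_nth (q * f) k"
    using assms(1) by (simp add: log_deriv_def mult.commute)
  also have "\<dots> = (\<Sum>i=0..k. fps_nth q i * fps_nth f (k - i))"
    by (simp add: fps_mult_nth)
  also have "\<dots> = (\<Sum>i=1..k. fps_nth q i * fps_nth f (k - i))"
    using assms(2) by (simp add: sum.atLeast_Suc_atMost)
  finally show ?thesis .
qed

text \<open>The series is the geometric expansion of \<open>- m c t^m / (1 - c t^m)\<close>.\<close>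

lemma log_deriv_one_minus_monom:
  fixes c :: "'b::comm_ring_1"
  assumes m: "m \<ge> 1"
  shows "log_deriv (1 - fps_const c * fps_X ^ m)
           (Abs_fps (\<lambda>k. if k > 0 \<and> m dvd k then - of_nat m * c ^ (k div m) else 0))"
    (is "log_deriv ?g ?u")
proof -
  have "fps_nth (fps_X * fps_deriv ?g) k = fps_nth (?g * ?u) k" for k
  proof -
    have nth_g: "fps_nth (?g * ?u) k = fps_nth ?u k - (if k < m then 0 else c * fps_nth ?u (k - m))"
      by (simp add: left_diff_distrib mult.assoc fps_X_power_mult_nth)
    have nth_d: "fps_nth (fps_X * fps_deriv ?g) k = (if k = m then - of_nat m * c else 0)"
      using m by (cases k) auto
    \<comment> \<open>Both sides vanish below \<open>m\<close>. At \<open>m\<close> the shifted term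
      is 0 because \<open>?u\<close> has constant term 0. Above \<open>m\<close>, terms at distance
      \<open>m\<close> cancel.\<close>
    consider "k < m" | "k = m" | "k > m" by linarith
    then show ?thesis
    proof cases
      case 1
      then show ?thesis unfolding nth_g nth_d by (auto dest: dvd_imp_le)
    next
      case 2
      then show ?thesis unfolding nth_g nth_d using m by simp
    next
      case 3
      then have "m dvd k - m \<longleftrightarrow> m dvd k" by (simp add: dvd_minus_self)
      moreover have "k div m = Suc ((k - m) div m)" using 3 m by (simp add: le_div_geq)
      ultimately show ?thesis unfolding nth_g nth_d using 3 by (simp add: algebra_simps)
    qed
  qed
  then show ?thesis by (simp add: log_deriv_def fps_eq_iff)
qed

text \<open>With \<open>y = a t\<close>, these are the coefficients of
  \<open>y / (1 - y) - (s+1) y^(s+1) / (1 - y^(s+1))\<close>: at positive multiples of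
  \<open>s+1\<close> the sum is \<open>1 - (s+1) = - s\<close>.\<close>

definition factor_coeff :: "nat \<Rightarrow> nat \<Rightarrow> 'b::comm_ring_1" where
  "factor_coeff s k = (if k = 0 then 0 else if Suc s dvd k then - of_nat s else 1)"

lemma log_deriv_factor:
  fixes a :: "'b::comm_ring_1"
  shows "log_deriv (\<Sum>j=0..s. (fps_const a * fps_X) ^ j) (Abs_fps (\<lambda>k. factor_coeff s k * a ^ k))"
    (is "log_deriv ?f ?q")
proof -
  let ?y = "fps_const a * fps_X :: 'b fps"
  let ?u = "\<lambda>m c. Abs_fps (\<lambda>k. if k > 0 \<and> m dvd k then - of_nat m * (c::'b) ^ (k div m) else 0)"
  \<comment> \<open>The geometric series serves as the inverse of \<open>1 - ?y\<close>.\<close>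
  define G where "G = Abs_fps (\<lambda>k. a ^ k)"
  have inv: "(1 - ?y) * G = 1"
  proof (rule fps_ext)
    fix k show "fps_nth ((1 - ?y) * G) k = fps_nth 1 k"
      by (cases k) (auto simp: G_def algebra_simps)
  qed
  have "log_deriv (1 - ?y) (?u 1 a)"
    using log_deriv_one_minus_monom[of 1 a] by simp
  from log_deriv_inverse[OF this inv] have G: "log_deriv G (- ?u 1 a)" .
  have "(1 - ?y) * ?f = 1 - ?y ^ Suc s"
    using one_diff_power_eq[of ?y "Suc s"] by (simp add: atLeast0AtMost lessThan_Suc_atMost)
  also have "\<dots> = 1 - fps_const (a ^ Suc s) * fps_X ^ Suc s"
    by (simp only: power_mult_distrib fps_const_power)
  finally have yf: "(1 - ?y) * ?f = 1 - fps_const (a ^ Suc s) * fps_X ^ Suc s" .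
  have "?f = ((1 - ?y) * G) * ?f" by (simp only: inv mult_1)
  also have "\<dots> = (1 - fps_const (a ^ Suc s) * fps_X ^ Suc s) * G"
    by (simp only: mult.assoc mult.commute[of G] flip: yf)
  finally have f: "?f = (1 - fps_const (a ^ Suc s) * fps_X ^ Suc s) * G" .
  have "log_deriv ?f (?u (Suc s) (a ^ Suc s) + - ?u 1 a)"
    unfolding f by (intro log_deriv_mult log_deriv_one_minus_monom G) simp
  moreover have "?u (Suc s) (a ^ Suc s) + - ?u 1 a = ?q"
  proof (rule fps_ext)
    fix k
    have "(a ^ Suc s) ^ (k div Suc s) = a ^ k" if "Suc s dvd k"
      using that by (metis dvd_mult_div_cancel power_mult)
    then show "fps_nth (?u (Suc s) (a ^ Suc s) + - ?u 1 a) k = fps_nth ?q k"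
      by (simp add: factor_coeff_def algebra_simps del: power_Suc)
  qed
  ultimately show ?thesis by simp
qed

text \<open>The first form serves \<open>H\<close>, where the variable is negated and the factor
  inverted; the second serves \<open>E\<close>. Index 0 is excluded since
  \<open>factor_coeff\<close> is 0 there while \<open>P_coeff\<close> is \<open>s\<close>.\<close>

lemma P_coeff_factor_coeff:
  assumes "k \<ge> 1"
  shows "P_coeff s k = - ((-1) ^ k * factor_coeff s k :: 'b::comm_ring_1)"
    and "factor_coeff s k = ((-1) ^ (k - 1) * P_coeff s k :: 'b)"
proof -
  obtain j where k: "k = Suc j" using assms by (cases k) auto
  show "P_coeff s k = - ((-1) ^ k * factor_coeff s k :: 'b)"
    by (simp add: k P_coeff_def factor_coeff_def dvd_eq_mod_eq_0)
  show "factor_coeff s k = ((-1) ^ (k - 1) * P_coeff s k :: 'b)"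
    by (cases "even j") (simp_all add: k P_coeff_def factor_coeff_def dvd_eq_mod_eq_0)
qed

section \<open>The recurrences of \<open>E\<close> and \<open>H\<close>\<close>

lemma factor_nth_0:
  fixes a :: "'b::comm_ring_1"
  shows "fps_nth (\<Sum>j=0..s. (fps_const a * fps_X) ^ j) 0 = 1"
proof -
  have "fps_nth ((fps_const a * fps_X) ^ j) 0 = (if j = 0 then 1 else 0)" for j
    by (cases j) simp_all
  then show ?thesis by (simp add: fps_sum_nth)
qed

lemma fps_prod_nth_0: "fps_nth (\<Prod>i\<in>A. f i) 0 = (\<Prod>i\<in>A. fps_nth (f i) 0)"
  by (induction A rule: infinite_finite_induct) auto

lemma E_fun_0: "E_fun s n x 0 = 1"
  by (simp add: E_fun_def fps_prod_nth_0 factor_nth_0)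

lemma H_fun_0: "H_fun s n x 0 = 1"
  by (simp add: H_fun_def fps_prod_nth_0)

lemma E_fun_rec:
  assumes "k \<ge> 1"
  shows "of_nat k * E_fun s n x k = (\<Sum>i=1..k. (-1) ^ (i - 1) * P_fun s n x i * E_fun s n x (k - i))"
proof -
  let ?q = "\<Sum>i=1..n. Abs_fps (\<lambda>k. factor_coeff s k * x i ^ k)"
  have "log_deriv (\<Prod>i=1..n. \<Sum>j=0..s. (fps_const (x i) * fps_X) ^ j) ?q"
    by (intro log_deriv_prod log_deriv_factor)
  moreover have "fps_nth ?q 0 = 0"
    by (simp add: fps_sum_nth factor_coeff_def)
  ultimately have "of_nat k * E_fun s n x k = (\<Sum>i=1..k. fps_nth ?q i * E_fun s n x (k - i))"
    unfolding E_fun_def using assms by (rule log_deriv_nth)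
  also have "\<dots> = (\<Sum>i=1..k. (-1) ^ (i - 1) * P_fun s n x i * E_fun s n x (k - i))"
  proof (rule sum.cong)
    fix i assume "i \<in> {1..k}"
    then have "fps_nth ?q i = (-1) ^ (i - 1) * P_fun s n x i"
      by (simp add: fps_sum_nth P_fun_def P_coeff_factor_coeff(2) sum_distrib_left mult.assoc)
    then show "fps_nth ?q i * E_fun s n x (k - i)
        = (-1) ^ (i - 1) * P_fun s n x i * E_fun s n x (k - i)" by simp
  qed simp
  finally show ?thesis .
qed

lemma H_fun_rec:
  assumes "k \<ge> 1"
  shows "of_nat k * H_fun s n x k = (\<Sum>i=1..k. P_fun s n x i * H_fun s n x (k - i))"
proof -
  let ?q = "\<Sum>i=1..n. - Abs_fps (\<lambda>k. factor_coeff s k * (- x i) ^ k)"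
  \<comment> \<open>The factor of \<open>H\<close> is the inverse of the factor of \<open>E\<close>
    at \<open>- a\<close>, and inversion negates the logarithmic derivative.\<close>
  have "log_deriv (fps_right_inverse (\<Sum>j=0..s. (- (fps_const a * fps_X)) ^ j) 1)
      (- Abs_fps (\<lambda>k. factor_coeff s k * (- a) ^ k))" for a :: 'a
    using log_deriv_factor[where a = "- a"]
    by (intro log_deriv_inverse[OF _ H_factor_inverse]) (simp flip: fps_const_neg)
  then have "log_deriv
      (\<Prod>i=1..n. fps_right_inverse (\<Sum>j=0..s. (- (fps_const (x i) * fps_X)) ^ j) 1) ?q"
    by (intro log_deriv_prod)
  moreover have "fps_nth ?q 0 = 0"
    by (simp add: fps_sum_nth factor_coeff_def)
  ultimately have "of_nat k * H_fun s n x k = (\<Sum>i=1..k. fps_nth ?q i * H_fun s n x (k - i))"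
    unfolding H_fun_def using assms by (rule log_deriv_nth)
  also have "\<dots> = (\<Sum>i=1..k. P_fun s n x i * H_fun s n x (k - i))"
  proof (rule sum.cong)
    fix i assume "i \<in> {1..k}"
    then have "fps_nth ?q i = P_fun s n x i"
      by (simp add: fps_sum_nth P_fun_def P_coeff_factor_coeff(1) sum_distrib_left sum_negf
          power_minus[of "x _"] ac_simps)
    then show "fps_nth ?q i * H_fun s n x (k - i) = P_fun s n x i * H_fun s n x (k - i)" by simp
  qed simp
  finally show ?thesis .
qed

section \<open>The expansions\<close>

lemma Const_mult: "Const a * Const b = Const (a * b)"
  by (simp add: Const_def mult_single)

lemma Const_of_nat: "Const (of_nat m) = of_nat m"
  by (simp add: Const_def single_of_nat)

lemma Const_minus_one_power: "Const ((-1) ^ m) = (-1) ^ m"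
proof (induction m)
  case (Suc m)
  have "Const (- 1) = (- 1 :: 'a mpoly)"
    by (simp add: Const_def single_uminus)
  then show ?case using Suc by (simp only: power_Suc flip: Const_mult)
qed (simp add: Const_def)

text \<open>Characteristic zero enters here; the constants \<open>1 / m\<close> become an admissible
  choice of \<open>r\<close>.\<close>

lemma Const_reciprocal:
  assumes "m > 0"
  shows "of_nat m * Const (1 / of_nat m :: 'a::field_char_0) = 1"
  using assms by (simp add: Const_mult flip: Const_of_nat) (simp add: Const_def)

lemma weighted_tuples_eq_tuples: "weighted_tuples k = tuples k k"
  by (simp add: weighted_tuples_def tuples_def)

text \<open>The exponents \<open>i - 1\<close> and \<open>i + 1\<close> have equal parity, and the
  sum of \<open>(i + 1) * t i\<close> is \<open>k\<close> plus the number of parts.\<close>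

lemma weighted_tuples_sign:
  assumes "t \<in> weighted_tuples k"
  shows "(\<Prod>i=1..k. ((-1) ^ (i - 1)) ^ t i) = ((-1) ^ (k + (\<Sum>i=1..k. t i)) :: 'b::comm_ring_1)"
proof -
  have "(\<Prod>i=1..k. ((-1) ^ (i - 1)) ^ t i) = (\<Prod>i=1..k. (-1) ^ (i * t i + t i) :: 'b)"
  proof (rule prod.cong)
    fix i assume "i \<in> {1..k}"
    then obtain j where "i = Suc j" by (cases i) auto
    then show "((-1) ^ (i - 1)) ^ t i = ((-1) ^ (i * t i + t i) :: 'b)"
      by (simp add: power_add ac_simps flip: power_mult power_mult_distrib)
  qed simp
  also have "\<dots> = (-1) ^ (\<Sum>i=1..k. i * t i + t i)"
    by (simp add: power_sum)
  also have "(\<Sum>i=1..k. i * t i + t i) = k + (\<Sum>i=1..k. t i)"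
    using assms by (simp add: weighted_tuples_def sum.distrib)
  finally show ?thesis .
qed

theorem theorem2p8:
  fixes k n s :: nat and x :: "nat \<Rightarrow> 'a::field_char_0 mpoly"
  assumes "k \<ge> 1" and "n \<ge> 1" and "s \<ge> 1"
    and "x = Var"
  shows "H_fun s n x k =
           (\<Sum>t\<in>weighted_tuples k.
              Const (1 / of_nat (z_weight k t)) * (\<Prod>i=1..k. P_fun s n x i ^ t i))
       \<and> E_fun s n x k =
           (\<Sum>t\<in>weighted_tuples k.
              Const ((-1) ^ (k + (\<Sum>i=1..k. t i)) / of_nat (z_weight k t)) *
              (\<Prod>i=1..k. P_fun s n x i ^ t i))"
proof -
  \<comment> \<open>Both expansions are instances of the same tuple sum with \<open>N = k\<close>;
    for \<open>E\<close> the sequence is \<open>P_fun\<close> with alternating signs, which are then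
    collected into one sign per tuple.\<close>
  let ?r = "\<lambda>m. Const (1 / of_nat m) :: 'a mpoly"
  have H: "H_fun s n x k = tuple_sum ?r (P_fun s n x) k k"
    by (rule tuple_sum_unique[of ?r, OF Const_reciprocal H_fun_0 H_fun_rec]) auto
  have E: "E_fun s n x k = tuple_sum ?r (\<lambda>i. (-1) ^ (i - 1) * P_fun s n x i) k k"
    by (rule tuple_sum_unique[of ?r, OF Const_reciprocal E_fun_0 E_fun_rec]) auto
  have "E_fun s n x k = (\<Sum>t\<in>weighted_tuples k.
      Const ((-1) ^ (k + (\<Sum>i=1..k. t i)) / of_nat (z_weight k t)) *
      (\<Prod>i=1..k. P_fun s n x i ^ t i))"
    unfolding E tuple_sum_def tuple_term_def weighted_tuples_eq_tuples[symmetric]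
  proof (rule sum.cong)
    fix t assume t: "t \<in> weighted_tuples k"
    let ?e = "k + (\<Sum>i=1..k. t i)" and ?z = "of_nat (z_weight k t) :: 'a"
    have "Const ((-1) ^ ?e / ?z) = (-1) ^ ?e * Const (1 / ?z)"
      by (simp add: Const_mult flip: Const_minus_one_power)
    then show "Const (1 / ?z) * (\<Prod>i=1..k. ((-1) ^ (i - 1) * P_fun s n x i) ^ t i)
        = Const ((-1) ^ ?e / ?z) * (\<Prod>i=1..k. P_fun s n x i ^ t i)"
      by (simp only: power_mult_distrib prod.distrib weighted_tuples_sign[OF t] mult.assoc mult.left_commute)
  qed simp
  moreover have "H_fun s n x k = (\<Sum>t\<in>weighted_tuples k.
      Const (1 / of_nat (z_weight k t)) * (\<Prod>i=1..k. P_fun s n x i ^ t i))"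
    unfolding H tuple_sum_def tuple_term_def weighted_tuples_eq_tuples ..
  ultimately show ?thesis by blast
qed

end
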